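(* Let $\theta\in(0,1]$, $r=1$, and let $\{Z_n\}_{n\ge0}$ be a GW$^{\,\theta}$-process with parameters $(\theta,1,a_n,c_n)_{n\ge1}$. Suppose $C=\lim_{n\to\infty} C_n<\infty$ and $A_n\to A\in(0,\infty)$. Then $$q=1-(A+C)^{-1/\theta},\qquad \mathrm{E}(Z_n)\to A^{-1/\theta},$$ and $Z_n$ converges almost surely to a random variable $Z_\infty$ such that $$\mathrm{E}(Z_\infty)=A^{-1/\theta},\quad \mathrm{E}(s^{Z_\infty})=1-(A(1-s)^{-\theta}+C)^{-1/\theta},\quad 0\le s\le1.$$
   Context: All limits are as $n\to\infty$. Let $\theta\in(0,1]$, $r=1$, and let $(a_n,c_n)_{n\ge1}$ be real sequences with $0<a_n<\infty$, $c_n>0$, $c_n\ge 1-a_n$ for all $n\ge1$. Put $$f_n(s)=1-(a_n(1-s)^{-\theta}+c_n)^{-1/\theta},\quad 0\le s<1,\qquad f_n(1)=1.$$ Each $f_n(s)=\sum_{j\ge0}p_n(j)s^j$ is a probability generating function. The GW$^{\,\theta}$-process with parameters $(\theta,1,a_n,c_n)_{n\ge1}$ is the Galton-Watson process in a varying environment $\{Z_n\}_{n\ge0}$ with $Z_0=1$, $Z_n=\sum_{i=1}^{Z_{n-1}}X_{n,i}$, where $\{X_{n,i}\}_{n,i\ge1}$ are independent and $\mathrm{P}(X_{n,i}=j)=p_n(j)$. Thus $\mathrm{E}(s^{Z_n})=f_1\circ\cdots\circ f_n(s)$. The extinction probability is $q=\lim \mathrm{P}(Z_n=0)$. Notation: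 $A_0=1$, $A_n=\prod_{i=1}^n a_i$, $C_n=\sum_{i=1}^n A_{i-1}c_i$, $C=\lim C_n\in(0,\infty]$. Conventions: $0^{-\theta}=\infty$, $\infty^{-1/\theta}=0$. *)

theory Defs
  imports "HOL-Probability.Probability"
begin

(* The value at s = 1 is the convention 0^(-theta) = infinity, infinity^(-1/theta) = 0;
   it has to be given separately because 0 powr x = 0 in HOL. *)
definition theta_pgf :: "real \<Rightarrow> real \<Rightarrow> real \<Rightarrow> real \<Rightarrow> real" where
  "theta_pgf \<theta> a c s =
     (if s = 1 then 1 else 1 - (a * (1 - s) powr (- \<theta>) + c) powr (- 1 / \<theta>))"

(* Z_n = X_{n,1} + ... + X_{n,Z_{n-1}} with Z_0 = 1; only indices n, i >= 1 of X are used. *)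
primrec gw_process :: "(nat \<Rightarrow> nat \<Rightarrow> 'w \<Rightarrow> nat) \<Rightarrow> nat \<Rightarrow> 'w \<Rightarrow> nat" where
  "gw_process X 0 \<omega> = 1"
| "gw_process X (Suc n) \<omega> = (\<Sum>i = 1..gw_process X n \<omega>. X (Suc n) i \<omega>)"

(* p n j is the coefficient of s^j in f_n = theta_pgf \<theta> (a n) (c n). Nonnegativity of these
   coefficients is not listed because it follows from X_law. *)
locale gw_theta = prob_space M
  for M :: "'w measure" +
  fixes \<theta> :: real
    and a c :: "nat \<Rightarrow> real"
    and p :: "nat \<Rightarrow> nat \<Rightarrow> real"
    and X :: "nat \<Rightarrow> nat \<Rightarrow> 'w \<Rightarrow> nat"
  assumes theta: "0 < \<theta>" "\<theta> \<le> 1"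
    and a_pos: "\<And>n. n \<ge> 1 \<Longrightarrow> 0 < a n"
    and c_pos: "\<And>n. n \<ge> 1 \<Longrightarrow> 0 < c n"
    and c_ge: "\<And>n. n \<ge> 1 \<Longrightarrow> 1 - a n \<le> c n"
    and p_pgf: "\<And>n s. n \<ge> 1 \<Longrightarrow> 0 \<le> s \<Longrightarrow> s \<le> 1 \<Longrightarrow>
                  (\<lambda>j. p n j * s ^ j) sums theta_pgf \<theta> (a n) (c n) s"
    and X_indep: "indep_vars (\<lambda>_. count_space UNIV) (\<lambda>(n, i). X n i) ({1..} \<times> {1..})"
    and X_law: "\<And>n i j. n \<ge> 1 \<Longrightarrow> i \<ge> 1 \<Longrightarrow>
                  prob {\<omega> \<in> space M. X n i \<omega> = j} = p n j"

definition A_seq :: "(nat \<Rightarrow> real) \<Rightarrow> nat \<Rightarrow> real" where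
  "A_seq a n = (\<Prod>i = 1..n. a i)"

definition C_seq :: "(nat \<Rightarrow> real) \<Rightarrow> (nat \<Rightarrow> real) \<Rightarrow> nat \<Rightarrow> real" where
  "C_seq a c n = (\<Sum>i = 1..n. A_seq a (i - 1) * c i)"

end

theory Submission
  imports Defs
begin

text \<open>The family \<open>theta_pgf \<theta>\<close> is closed under composition, which gives the generating function of
  \<open>Z\<^sub>n\<close> with parameters \<open>A\<^sub>n\<close>, \<open>C\<^sub>n\<close>, and hence \<open>P(Z\<^sub>n = 0)\<close> and \<open>E(Z\<^sub>n)\<close>.
  Almost sure convergence of the integer-valued \<open>Z\<^sub>n\<close> means that it is eventually constant, so by
  Borel-Cantelli it suffices that \<open>P(Z\<^sub>n\<^sub>+\<^sub>1 \<noteq> Z\<^sub>n)\<close> is summable. This probability is at most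
  \<open>E(Z\<^sub>n) P(X \<noteq> 1)\<close> for an offspring variable \<open>X\<close> of generation \<open>n + 1\<close>, and
  \<open>P(X \<noteq> 1) \<le> 2 P(X = 0) + E(X) - 1\<close>. Both contributions are dominated by telescoping series:
  \<open>E(Z\<^sub>n) (E(X) - 1) = E(Z\<^sub>n\<^sub>+\<^sub>1) - E(Z\<^sub>n)\<close>, while \<open>P(X = 0) \<le> (a\<^sub>n\<^sub>+\<^sub>1 + c\<^sub>n\<^sub>+\<^sub>1 - 1) / \<theta>\<close> and
  \<open>A\<^sub>n (a\<^sub>n\<^sub>+\<^sub>1 + c\<^sub>n\<^sub>+\<^sub>1 - 1)\<close> is the increment of \<open>A\<^sub>n + C\<^sub>n\<close>.\<close>

section \<open>Composition and continuity of the generating functions\<close>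

text \<open>In the coordinate \<open>(1 - s) powr (- \<theta>)\<close> the function
  \<open>theta_pgf \<theta> a c\<close> acts as the affine map sending \<open>u\<close> to
  \<open>a * u + c\<close>, and affine maps compose in this way.\<close>

lemma theta_pgf_compose:
  assumes "\<theta> > 0" "a > 0" "c \<ge> 0" "0 \<le> s" "s \<le> 1"
  shows "theta_pgf \<theta> A C (theta_pgf \<theta> a c s) = theta_pgf \<theta> (A * a) (C + A * c) s"
proof (cases "s = 1")
  case True
  then show ?thesis by (simp add: theta_pgf_def)
next
  case False
  define D where "D = a * (1 - s) powr (- \<theta>) + c"
  have D: "D > 0"
    using assms False by (simp add: D_def add_pos_nonneg)
  have "(D powr (- 1 / \<theta>)) powr (- \<theta>) = D"
    using D assms by (simp add: powr_powr)
  \<comment> \<open>This excludes the inner value 1, so the outer \<open>theta_pgf\<close> is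
    evaluated in its main branch.\<close>
  moreover have "D powr (- 1 / \<theta>) \<noteq> 0"
    using D by simp
  ultimately show ?thesis
    using False by (simp add: theta_pgf_def flip: D_def) (simp add: D_def algebra_simps)
qed

lemma theta_pgf_one_zero:
  assumes "\<theta> > 0" "s \<le> 1"
  shows "theta_pgf \<theta> 1 0 s = s"
  using assms by (simp add: theta_pgf_def powr_powr)

lemma theta_pgf_tendsto:
  assumes "A \<longlonglongrightarrow> A'" "C \<longlonglongrightarrow> C'" "A' > 0" "C' \<ge> 0" "s \<le> 1"
  shows "(\<lambda>n. theta_pgf \<theta> (A n) (C n) s) \<longlonglongrightarrow> theta_pgf \<theta> A' C' s"
proof (cases "s = 1")
  case False
  have "A' * (1 - s) powr (- \<theta>) + C' > 0"
    using assms False by (simp add: add_pos_nonneg)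
  then show ?thesis
    using False assms unfolding theta_pgf_def by (auto intro!: tendsto_intros)
qed (simp add: theta_pgf_def)

text \<open>Combines the tangent bounds \<open>1 + x \<le> exp x\<close> and
  \<open>ln y \<le> y - 1\<close>. With \<open>b = 1 / \<theta>\<close> and \<open>y = a + c\<close>
  it bounds the probability of having no offspring.\<close>

lemma one_minus_powr_neg_le:
  fixes y b :: real
  assumes "y \<ge> 1" "b \<ge> 0"
  shows "1 - y powr (- b) \<le> b * (y - 1)"
proof -
  have "1 - b * ln y \<le> y powr (- b)"
    using exp_ge_add_one_self[of "- b * ln y"] assms by (simp add: powr_def)
  moreover have "b * ln y \<le> b * (y - 1)"
    using assms ln_le_minus_one[of y] by (intro mult_left_mono) auto
  ultimately show ?thesis by simp
qed

section \<open>Integer-valued random variables: level sets, mean and atoms\<close>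

text \<open>Dominated convergence, the partial sums being \<open>W\<close> cut off where
  \<open>Y \<ge> N\<close>. \<open>W\<close> need not be a function of \<open>Y\<close>, which
  allows products with a random number \<open>Y\<close> of factors.\<close>

lemma (in prob_space) expectation_sums_level_sets:
  fixes W :: "'a \<Rightarrow> real"
  assumes Y[measurable]: "Y \<in> measurable M (count_space (UNIV :: nat set))"
    and W[measurable]: "W \<in> borel_measurable M"
    and bound: "\<And>\<omega>. \<bar>W \<omega>\<bar> \<le> 1"
  shows "(\<lambda>k. \<integral>\<omega>. indicator {k} (Y \<omega>) * W \<omega> \<partial>M) sums (\<integral>\<omega>. W \<omega> \<partial>M)"
proof -
  have int: "integrable M (\<lambda>\<omega>. indicator {k} (Y \<omega>) * W \<omega>)" for k
    by (rule integrable_const_bound[where B = 1])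
      (use bound in \<open>auto simp: indicator_def\<close>)
  have part: "(\<Sum>k<N. indicator {k} (Y \<omega>) * W \<omega>) = (if Y \<omega> < N then W \<omega> else 0)" for N \<omega>
    by (simp add: indicator_def if_distrib sum.delta cong: if_cong flip: sum_distrib_right)
  have "(\<lambda>N. \<integral>\<omega>. (if Y \<omega> < N then W \<omega> else 0) \<partial>M) \<longlonglongrightarrow> (\<integral>\<omega>. W \<omega> \<partial>M)"
  proof (rule integral_dominated_convergence[where w = "\<lambda>_. 1"])
    show "AE \<omega> in M. (\<lambda>N. if Y \<omega> < N then W \<omega> else 0) \<longlonglongrightarrow> W \<omega>"
    proof (rule AE_I2)
      fix \<omega>
      have "eventually (\<lambda>N. (if Y \<omega> < N then W \<omega> else 0) = W \<omega>) sequentially"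
        using eventually_gt_at_top[of "Y \<omega>"] by eventually_elim simp
      then show "(\<lambda>N. if Y \<omega> < N then W \<omega> else 0) \<longlonglongrightarrow> W \<omega>"
        by (rule tendsto_eventually)
    qed
  qed (use bound in auto)
  then show ?thesis
    using int by (simp add: sums_def part flip: Bochner_Integration.integral_sum)
qed

lemma (in prob_space) prob_eq_expectation_indicator:
  assumes [measurable]: "Y \<in> measurable M (count_space (UNIV :: nat set))"
  shows "expectation (\<lambda>\<omega>. indicator {k} (Y \<omega>)) = prob {\<omega> \<in> space M. Y \<omega> = k}"
proof -
  have "expectation (\<lambda>\<omega>. indicator {k} (Y \<omega>)) =
      (expectation (indicator {\<omega> \<in> space M. Y \<omega> = k}) :: real)"
    by (intro Bochner_Integration.integral_cong) (auto simp: indicator_def)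
  then show ?thesis by simp
qed

lemma (in prob_space) expectation_sums_nat:
  fixes g :: "nat \<Rightarrow> real"
  assumes Y[measurable]: "Y \<in> measurable M (count_space (UNIV :: nat set))"
    and bound: "\<And>k. \<bar>g k\<bar> \<le> 1"
  shows "(\<lambda>k. prob {\<omega> \<in> space M. Y \<omega> = k} * g k) sums expectation (\<lambda>\<omega>. g (Y \<omega>))"
proof -
  have "(\<lambda>\<omega>. indicator {k} (Y \<omega>) * g (Y \<omega>)) = (\<lambda>\<omega>. indicator {k} (Y \<omega>) * g k)" for k
    by (auto simp: indicator_def)
  then show ?thesis
    using expectation_sums_level_sets[OF Y, of "\<lambda>\<omega>. g (Y \<omega>)"] bound
    by (simp add: prob_eq_expectation_indicator)
qed

text \<open>The mean is the left derivative of the generating function at 1, obtained by monotone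
  convergence from \<open>(1 - s ^ Y) / (1 - s) = (\<Sum>j<Y. s ^ j)\<close>, which increases to \<open>Y\<close>.\<close>

lemma (in prob_space) theta_pgf_mean:
  assumes Y[measurable]: "Y \<in> measurable M (count_space (UNIV :: nat set))"
    and pgf: "\<And>s. 0 \<le> s \<Longrightarrow> s \<le> 1 \<Longrightarrow> expectation (\<lambda>\<omega>. s ^ Y \<omega>) = theta_pgf \<theta> a c s"
    and pos: "\<theta> > 0" "a > 0" "c \<ge> 0"
  shows "integrable M (\<lambda>\<omega>. real (Y \<omega>))"
    and "expectation (\<lambda>\<omega>. real (Y \<omega>)) = a powr (- 1 / \<theta>)"
proof -
  define s where "s k = 1 - 1 / real (Suc k)" for k
  have s: "0 \<le> s k" "s k < 1" for k
    by (auto simp: s_def)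
  have s_lim: "s \<longlonglongrightarrow> 1"
    unfolding s_def by real_asymp
  have s_mono: "s k \<le> s l" if "k \<le> l" for k l
    using that by (simp add: s_def frac_le)
  define f where "f k \<omega> = (\<Sum>j<Y \<omega>. s k ^ j)" for k \<omega>
  have f_eq: "f k \<omega> = (1 - s k ^ Y \<omega>) / (1 - s k)" for k \<omega>
    using s[of k] by (simp add: f_def sum_gp_strict)
  have pow_int: "integrable M (\<lambda>\<omega>. s k ^ Y \<omega>)" for k
    by (rule integrable_const_bound[where B = 1])
      (use s[of k] in \<open>auto intro!: AE_I2 power_le_one\<close>)
  have f_int: "integrable M (f k)" for k
    using pow_int by (simp add: f_eq[abs_def])
  have f_mean: "expectation (f k) = (1 - theta_pgf \<theta> a c (s k)) / (1 - s k)" for k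
    using pow_int s[of k] by (simp add: f_eq[abs_def] pgf prob_space)
  \<comment> \<open>Moving a factor \<open>u powr \<theta>\<close> into the base absorbs the
    division by \<open>u\<close> and leaves an expression whose limit at \<open>u = 0\<close> is
    visible.\<close>
  have quotient: "(1 - theta_pgf \<theta> a c (s k)) / (1 - s k) = (a + c * (1 - s k) powr \<theta>) powr (- 1 / \<theta>)" for k
  proof -
    define u where "u = 1 - s k"
    have u: "u > 0" using s[of k] by (simp add: u_def)
    have "u powr (- \<theta>) * u powr \<theta> = 1"
      using u by (simp flip: powr_add)
    then have "(a + c * u powr \<theta>) = (a * u powr (- \<theta>) + c) * u powr \<theta>"
      by (simp add: algebra_simps)
    moreover have "(u powr \<theta>) powr (- 1 / \<theta>) = inverse u"
      using u pos by (simp add: powr_powr powr_minus)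
    ultimately have "(a + c * u powr \<theta>) powr (- 1 / \<theta>) = (a * u powr (- \<theta>) + c) powr (- 1 / \<theta>) / u"
      using u pos by (simp add: powr_mult divide_inverse)
    then show ?thesis
      using s[of k] by (simp add: theta_pgf_def u_def)
  qed
  have "(\<lambda>k. (a + c * (1 - s k) powr \<theta>) powr (- 1 / \<theta>)) \<longlonglongrightarrow> (a + c * 0) powr (- 1 / \<theta>)"
  proof (intro tendsto_intros)
    have "(\<lambda>k. 1 - s k) \<longlonglongrightarrow> 0"
      using tendsto_diff[OF tendsto_const s_lim, of 1] by simp
    \<comment> \<open>The base tends to 0, so the limit relies on a positive exponent and a
      nonnegative base.\<close>
    then show "(\<lambda>k. (1 - s k) powr \<theta>) \<longlonglongrightarrow> 0"
      using tendsto_powr'[of "\<lambda>k. 1 - s k" 0 sequentially "\<lambda>_. \<theta>" \<theta>] s pos less_imp_le[OF s(2)] by simp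
  qed (use pos in auto)
  then have f_lim: "(\<lambda>k. expectation (f k)) \<longlonglongrightarrow> a powr (- 1 / \<theta>)"
    by (simp add: f_mean quotient)
  have mono: "AE \<omega> in M. mono (\<lambda>k. f k \<omega>)"
    using s s_mono by (auto simp: f_def mono_def intro!: sum_mono power_mono)
  have lim: "AE \<omega> in M. (\<lambda>k. f k \<omega>) \<longlonglongrightarrow> real (Y \<omega>)"
  proof (rule AE_I2)
    fix \<omega>
    have "(\<lambda>k. f k \<omega>) \<longlonglongrightarrow> (\<Sum>j<Y \<omega>. 1 ^ j)"
      unfolding f_def by (intro tendsto_intros s_lim)
    then show "(\<lambda>k. f k \<omega>) \<longlonglongrightarrow> real (Y \<omega>)" by simp
  qed
  show "integrable M (\<lambda>\<omega>. real (Y \<omega>))"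
    by (rule integrable_monotone_convergence[OF f_int mono lim f_lim]) simp
  show "expectation (\<lambda>\<omega>. real (Y \<omega>)) = a powr (- 1 / \<theta>)"
    by (rule integral_monotone_convergence[OF f_int mono lim f_lim]) simp
qed

lemma (in prob_space) theta_pgf_prob_zero:
  assumes Y[measurable]: "Y \<in> measurable M (count_space (UNIV :: nat set))"
    and pgf: "\<And>s. 0 \<le> s \<Longrightarrow> s \<le> 1 \<Longrightarrow> expectation (\<lambda>\<omega>. s ^ Y \<omega>) = theta_pgf \<theta> a c s"
  shows "prob {\<omega> \<in> space M. Y \<omega> = 0} = 1 - (a + c) powr (- 1 / \<theta>)"
proof -
  \<comment> \<open>By \<open>0 ^ 0 = 1\<close>, the generating function at 0 is the probability of
    the value 0.\<close>
  have "(indicator {0} k :: real) = 0 ^ k" for k :: nat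
    by (simp add: indicator_def)
  then show ?thesis
    using prob_eq_expectation_indicator[OF Y, of 0] pgf[of 0] by (simp add: theta_pgf_def)
qed

text \<open>The inequality already holds pointwise between the integrands, with equality at the
  values 0, 1 and 2. The factor 2 makes up for the negative term \<open>Y - 1\<close> at
  \<open>Y = 0\<close>.\<close>

lemma (in prob_space) prob_neq_one_le:
  assumes Y[measurable]: "Y \<in> measurable M (count_space (UNIV :: nat set))"
    and int: "integrable M (\<lambda>\<omega>. real (Y \<omega>))"
  shows "1 - prob {\<omega> \<in> space M. Y \<omega> = 1}
    \<le> 2 * prob {\<omega> \<in> space M. Y \<omega> = 0} + expectation (\<lambda>\<omega>. real (Y \<omega>)) - 1"
proof -
  have ind: "integrable M (\<lambda>\<omega>. indicator {k} (Y \<omega>) :: real)" for k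
    by (rule integrable_const_bound[where B = 1]) (auto simp: indicator_def)
  have "expectation (\<lambda>\<omega>. 1 - indicator {1} (Y \<omega>))
      \<le> expectation (\<lambda>\<omega>. 2 * indicator {0} (Y \<omega>) + real (Y \<omega>) - 1)"
    using ind int by (intro integral_mono) (auto simp: indicator_def)
  then show ?thesis
    using ind int by (simp add: prob_space prob_eq_expectation_indicator[OF Y])
qed

section \<open>Measurability of the process and its dependence on finitely many generations\<close>

lemma sets_Collect_eq_nat:
  fixes Y Y' :: "'a \<Rightarrow> nat"
  assumes [measurable]: "Y \<in> measurable N (count_space UNIV)" "Y' \<in> measurable N (count_space UNIV)"
  shows "{\<omega> \<in> space N. Y \<omega> = Y' \<omega>} \<in> sets N"
proof -
  have "{\<omega> \<in> space N. real (Y \<omega>) = real (Y' \<omega>)} \<in> sets N"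
    by measurable
  then show ?thesis by simp
qed

lemma measurable_sum_count_space_nat:
  fixes f :: "'b \<Rightarrow> 'a \<Rightarrow> nat"
  assumes "\<And>i. i \<in> I \<Longrightarrow> f i \<in> measurable N (count_space UNIV)"
  shows "(\<lambda>\<omega>. \<Sum>i\<in>I. f i \<omega>) \<in> measurable N (count_space UNIV)"
  using assms
proof (induction I rule: infinite_finite_induct)
  case (insert x F)
  then have [measurable]: "f x \<in> measurable N (count_space UNIV)"
    "(\<lambda>\<omega>. \<Sum>i\<in>F. f i \<omega>) \<in> measurable N (count_space UNIV)"
    by auto
  show ?case
    using insert by simp
qed auto

text \<open>A sum up to a random index is measurable because the index takes countably many values.
  \<open>N\<close> is arbitrary so that coordinate functions on a product space are covered
  too.\<close>

lemma gw_process_measurable: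
  assumes X: "\<And>m i. 1 \<le> m \<Longrightarrow> m \<le> n \<Longrightarrow> 1 \<le> i \<Longrightarrow> X m i \<in> measurable N (count_space UNIV)"
  shows "gw_process X n \<in> measurable N (count_space UNIV)"
  using X
proof (induction n)
  case 0
  then show ?case by (simp add: gw_process.simps(1)[abs_def])
next
  case (Suc n)
  have "(\<lambda>\<omega>. (\<lambda>k \<omega>. \<Sum>i = 1..k. X (Suc n) i \<omega>) (gw_process X n \<omega>) \<omega>)
      \<in> measurable N (count_space UNIV)"
    by (rule measurable_compose_countable)
      (use Suc in \<open>auto intro!: measurable_sum_count_space_nat\<close>)
  then show ?case by (simp add: gw_process.simps(2)[abs_def])
qed

text \<open>The two sample points may lie in different spaces; this identifies the process with the
  same recursion run on the coordinates of a product space.\<close>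

lemma gw_process_cong:
  assumes "\<And>m i. 1 \<le> m \<Longrightarrow> m \<le> n \<Longrightarrow> 1 \<le> i \<Longrightarrow> X m i \<omega> = X' m i \<omega>'"
  shows "gw_process X n \<omega> = gw_process X' n \<omega>'"
  using assms by (induction n) auto

lemma A_seq_0: "A_seq a 0 = 1"
  and A_seq_Suc: "A_seq a (Suc n) = A_seq a n * a (Suc n)"
  by (simp_all add: A_seq_def)

lemma C_seq_0: "C_seq a c 0 = 0"
  and C_seq_Suc: "C_seq a c (Suc n) = C_seq a c n + A_seq a n * c (Suc n)"
  by (simp_all add: C_seq_def)

section \<open>Offspring laws and independence of successive generations\<close>

context gw_theta
begin

lemma X_measurable:
  assumes "n \<ge> 1" "i \<ge> 1"
  shows "X n i \<in> measurable M (count_space UNIV)"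
  using X_indep assms by (auto simp: indep_vars_def)

lemma Z_measurable [measurable]: "gw_process X n \<in> measurable M (count_space UNIV)"
  by (rule gw_process_measurable) (rule X_measurable)

text \<open>The right side is free of \<open>i\<close>, so this also expresses that the offspring
  variables of one generation are identically distributed.\<close>

lemma X_expectation:
  fixes g :: "nat \<Rightarrow> real"
  assumes "n \<ge> 1" "i \<ge> 1" "\<And>k. \<bar>g k\<bar> \<le> 1"
  shows "expectation (\<lambda>\<omega>. g (X n i \<omega>)) = (\<Sum>k. p n k * g k)"
  using expectation_sums_nat[OF X_measurable[OF assms(1,2)] assms(3)] X_law[OF assms(1,2)]
  by (simp add: sums_iff)

lemma X_pgf:
  assumes "n \<ge> 1" "i \<ge> 1" "0 \<le> s" "s \<le> 1"
  shows "expectation (\<lambda>\<omega>. s ^ X n i \<omega>) = theta_pgf \<theta> (a n) (c n) s"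
  using X_expectation[OF assms(1,2), of "\<lambda>k. s ^ k"] p_pgf[OF assms(1,3,4)] assms
  by (simp add: sums_iff power_le_one)

text \<open>\<open>gw_process X n\<close> is a measurable function of the variables of generations 1
  to \<open>n\<close>, and functions of disjoint blocks of independent variables are
  independent.\<close>

lemma generation_indep:
  "indep_vars (\<lambda>_. count_space UNIV)
     (\<lambda>i. if i = 0 then gw_process X n else X (Suc n) i) UNIV"
proof -
  \<comment> \<open>Individuals are numbered from 1, so index 0 is free for the block that
    determines \<open>gw_process X n\<close>.\<close>
  define K where "K i = (if i = 0 then {1..n} \<times> {1..} else {(Suc n, i)})" for i :: nat
  define Y where "Y i w = (if i = 0 then gw_process (\<lambda>m j w. w (m, j)) n w else w (Suc n, i))"
    for i and w :: "nat \<times> nat \<Rightarrow> nat"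
  have "indep_vars (\<lambda>i. PiM (K i) (\<lambda>_. count_space UNIV))
      (\<lambda>i \<omega>. restrict (\<lambda>x. (case x of (m, j) \<Rightarrow> X m j) \<omega>) (K i)) UNIV"
    by (rule indep_vars_restrict[OF X_indep]) (auto simp: K_def disjoint_family_on_def)
  then have "indep_vars (\<lambda>_. count_space UNIV)
      (\<lambda>i \<omega>. Y i (restrict (\<lambda>x. (case x of (m, j) \<Rightarrow> X m j) \<omega>) (K i))) UNIV"
  proof (rule indep_vars_compose2)
    fix i
    show "Y i \<in> measurable (PiM (K i) (\<lambda>_. count_space UNIV)) (count_space UNIV)"
      unfolding Y_def
      by (cases "i = 0") (auto simp: K_def intro!: gw_process_measurable measurable_component_singleton)
  qed
  also have "(\<lambda>i \<omega>. Y i (restrict (\<lambda>x. (case x of (m, j) \<Rightarrow> X m j) \<omega>) (K i)))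
      = (\<lambda>i. if i = 0 then gw_process X n else X (Suc n) i)"
    by (auto simp: fun_eq_iff Y_def K_def intro!: gw_process_cong)
  finally show ?thesis .
qed

text \<open>Where generation \<open>n\<close> has size \<open>k\<close> the product has
  \<open>k\<close> factors independent of that event, so both sides have the same expansion over
  \<open>k\<close>. Powers of \<open>s\<close> as \<open>g\<close> yield the generating function,
  \<open>indicator {1}\<close> the probability that everyone has one child.\<close>

lemma expectation_prod_offspring:
  fixes g :: "nat \<Rightarrow> real"
  assumes g: "\<And>k. \<bar>g k\<bar> \<le> 1"
  shows "expectation (\<lambda>\<omega>. \<Prod>i = 1..gw_process X n \<omega>. g (X (Suc n) i \<omega>))
    = expectation (\<lambda>\<omega>. expectation (\<lambda>\<omega>. g (X (Suc n) 1 \<omega>)) ^ gw_process X n \<omega>)"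
proof -
  let ?m = "expectation (\<lambda>\<omega>. g (X (Suc n) 1 \<omega>))"
  let ?Z = "gw_process X n"
  define W where "W \<omega> = (\<Prod>i = 1..?Z \<omega>. g (X (Suc n) i \<omega>))" for \<omega>
  have Xm [measurable]: "X (Suc n) i \<in> measurable M (count_space UNIV)" if "i \<ge> 1" for i
    using that by (intro X_measurable) auto
  have W: "W \<in> borel_measurable M"
    unfolding W_def
    by (rule measurable_compose_countable[where f = "\<lambda>k \<omega>. \<Prod>i = 1..k. g (X (Suc n) i \<omega>)"])
      (auto intro!: borel_measurable_prod measurable_compose[OF Xm])
  have W_bound: "\<bar>W \<omega>\<bar> \<le> 1" for \<omega>
    unfolding W_def abs_prod using g by (intro prod_le_1) auto
  have m: "\<bar>?m\<bar> \<le> 1"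
  proof -
    have "integrable M (\<lambda>\<omega>. g (X (Suc n) 1 \<omega>))"
      by (rule integrable_const_bound[where B = 1])
        (use g in \<open>auto intro!: measurable_compose[OF Xm]\<close>)
    then show ?thesis
      using g integral_le_const[of "\<lambda>\<omega>. g (X (Suc n) 1 \<omega>)" 1]
        integral_ge_const[of "\<lambda>\<omega>. g (X (Suc n) 1 \<omega>)" "-1"]
      by (auto simp: abs_le_iff minus_le_iff)
  qed
  have level: "expectation (\<lambda>\<omega>. indicator {k} (?Z \<omega>) * W \<omega>) = prob {\<omega> \<in> space M. ?Z \<omega> = k} * ?m ^ k"
    for k
  proof -
    \<comment> \<open>Taking the indicator of the level set as factor 0 turns the integrand into a
      single product of independent variables.\<close>
    define h where "h i = (if i = 0 then indicator {k} else g)" for i :: nat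
    let ?V = "\<lambda>i \<omega>. h i ((if i = 0 then ?Z else X (Suc n) i) \<omega>)"
    have "indep_vars (\<lambda>_. borel) ?V UNIV"
      by (rule indep_vars_compose2[OF generation_indep]) simp
    then have ind: "indep_vars (\<lambda>_. borel) ?V {0..k}"
      by (rule indep_vars_subset) simp
    have int: "integrable M (?V i)" for i
      by (rule integrable_const_bound[where B = 1])
        (use g in \<open>auto simp: h_def indicator_def intro!: measurable_compose[OF Xm] measurable_compose[OF Z_measurable]\<close>)
    have split: "(\<Prod>i = 0..k. u i) = u 0 * (\<Prod>i = 1..k. u i)" for u :: "nat \<Rightarrow> real"
      by (simp add: prod.atLeast_Suc_atMost)
    have "indicator {k} (?Z \<omega>) * W \<omega> = (\<Prod>i = 0..k. ?V i \<omega>)" for \<omega>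
      unfolding split by (simp add: h_def W_def indicator_def)
    then have "expectation (\<lambda>\<omega>. indicator {k} (?Z \<omega>) * W \<omega>) = (\<Prod>i = 0..k. expectation (?V i))"
      using indep_vars_lebesgue_integral[OF _ ind int] by simp
    also have "\<dots> = prob {\<omega> \<in> space M. ?Z \<omega> = k} * (\<Prod>i = 1..k. ?m)"
      unfolding split using g
      by (auto simp: h_def prob_eq_expectation_indicator X_expectation intro!: prod.cong)
    finally show ?thesis by simp
  qed
  have "(\<lambda>k. prob {\<omega> \<in> space M. ?Z \<omega> = k} * ?m ^ k) sums expectation W"
    using expectation_sums_level_sets[OF Z_measurable W W_bound, of n] by (simp add: level)
  moreover have "(\<lambda>k. prob {\<omega> \<in> space M. ?Z \<omega> = k} * ?m ^ k) sums expectation (\<lambda>\<omega>. ?m ^ ?Z \<omega>)"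
    by (rule expectation_sums_nat[OF Z_measurable]) (unfold power_abs, rule power_le_one, use m in auto)
  ultimately show ?thesis
    unfolding W_def by (rule sums_unique2)
qed

section \<open>Generating function, mean and extinction probability of each generation\<close>

lemma A_seq_pos: "A_seq a n > 0"
  by (auto simp: A_seq_def intro!: prod_pos a_pos)

lemma C_seq_nonneg: "C_seq a c n \<ge> 0"
  by (auto simp: C_seq_def intro!: sum_nonneg mult_nonneg_nonneg less_imp_le[OF A_seq_pos] less_imp_le[OF c_pos])

text \<open>Generation \<open>n + 1\<close> enters as the innermost function, so the induction
  hypothesis is applied at \<open>?f\<close> and \<open>s\<close> has to be arbitrary.\<close>

lemma Z_pgf:
  assumes "0 \<le> s" "s \<le> 1"
  shows "expectation (\<lambda>\<omega>. s ^ gw_process X n \<omega>) = theta_pgf \<theta> (A_seq a n) (C_seq a c n) s"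
  using assms
proof (induction n arbitrary: s)
  case 0
  then show ?case
    using theta by (simp add: A_seq_0 C_seq_0 theta_pgf_one_zero prob_space)
next
  case (Suc n)
  let ?f = "theta_pgf \<theta> (a (Suc n)) (c (Suc n)) s"
  have f: "expectation (\<lambda>\<omega>. s ^ X (Suc n) 1 \<omega>) = ?f"
    using Suc.prems by (intro X_pgf) auto
  have "integrable M (\<lambda>\<omega>. s ^ X (Suc n) 1 \<omega>)"
    by (rule integrable_const_bound[where B = 1])
      (use Suc.prems in \<open>auto intro!: power_le_one measurable_compose[OF X_measurable]\<close>)
  \<comment> \<open>The bounds on \<open>?f\<close> come from its being the expectation of a power
    of \<open>s\<close>, not from its formula.\<close>
  then have "?f \<le> 1"
    unfolding f[symmetric] using Suc.prems by (intro integral_le_const) (auto intro: power_le_one)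
  moreover have "0 \<le> ?f"
    unfolding f[symmetric] using Suc.prems by simp
  moreover have "expectation (\<lambda>\<omega>. s ^ gw_process X (Suc n) \<omega>) = expectation (\<lambda>\<omega>. ?f ^ gw_process X n \<omega>)"
    using expectation_prod_offspring[of "\<lambda>k. s ^ k" n] Suc.prems
    by (simp add: f[simplified] power_sum power_le_one)
  ultimately have "expectation (\<lambda>\<omega>. s ^ gw_process X (Suc n) \<omega>) = theta_pgf \<theta> (A_seq a n) (C_seq a c n) ?f"
    by (simp add: Suc.IH)
  then show ?case
    using Suc.prems theta a_pos[of "Suc n"] c_pos[of "Suc n"]
    by (simp add: theta_pgf_compose A_seq_Suc C_seq_Suc)
qed

lemma Z_integrable: "integrable M (\<lambda>\<omega>. real (gw_process X n \<omega>))"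
  and Z_mean: "expectation (\<lambda>\<omega>. real (gw_process X n \<omega>)) = A_seq a n powr (- 1 / \<theta>)"
  using theta_pgf_mean[OF Z_measurable Z_pgf] theta A_seq_pos C_seq_nonneg by auto

lemma Z_prob_zero:
  "prob {\<omega> \<in> space M. gw_process X n \<omega> = 0} = 1 - (A_seq a n + C_seq a c n) powr (- 1 / \<theta>)"
  by (rule theta_pgf_prob_zero[OF Z_measurable Z_pgf])

section \<open>Summability of the jump probabilities\<close>

text \<open>The size is kept when every individual has exactly one child. That event has probability
  equal to the mean of \<open>?p ^ ?Z\<close>, which Bernoulli's inequality bounds below by an
  expression linear in \<open>?Z\<close>.\<close>

lemma prob_jump_le:
  "prob {\<omega> \<in> space M. gw_process X (Suc n) \<omega> \<noteq> gw_process X n \<omega>}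
    \<le> A_seq a n powr (- 1 / \<theta>) * (1 - prob {\<omega> \<in> space M. X (Suc n) 1 \<omega> = 1})"
proof -
  let ?Z = "gw_process X n" and ?Z' = "gw_process X (Suc n)"
  let ?W = "\<lambda>\<omega>. \<Prod>i = 1..?Z \<omega>. indicator {1} (X (Suc n) i \<omega>) :: real"
  let ?p = "prob {\<omega> \<in> space M. X (Suc n) 1 \<omega> = 1}"
  have p: "expectation (\<lambda>\<omega>. indicator {1} (X (Suc n) 1 \<omega>)) = ?p"
    by (intro prob_eq_expectation_indicator X_measurable) auto
  have W_ind: "?W \<omega> = (if \<forall>i\<in>{1..?Z \<omega>}. X (Suc n) i \<omega> = 1 then 1 else 0)" for \<omega>
    by (auto simp: indicator_def)
  \<comment> \<open>Only an inequality, since childless individuals may be offset by larger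
    families.\<close>
  have W_le: "?W \<omega> \<le> indicator {\<omega> \<in> space M. ?Z' \<omega> = ?Z \<omega>} \<omega>" if "\<omega> \<in> space M" for \<omega>
    unfolding W_ind using that by (auto simp: indicator_def)
  have stay: "{\<omega> \<in> space M. ?Z' \<omega> = ?Z \<omega>} \<in> events"
    by (rule sets_Collect_eq_nat) (rule Z_measurable)+
  have W: "?W \<in> borel_measurable M"
    by (rule measurable_compose_countable[where f = "\<lambda>k \<omega>. \<Prod>i = 1..k. indicator {1} (X (Suc n) i \<omega>)"])
      (auto intro!: borel_measurable_prod measurable_compose[OF X_measurable])
  have "1 - A_seq a n powr (- 1 / \<theta>) * (1 - ?p) = expectation (\<lambda>\<omega>. 1 + real (?Z \<omega>) * (?p - 1))"
    using Z_integrable[of n] by (simp add: Z_mean prob_space algebra_simps)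
  also have "\<dots> \<le> expectation (\<lambda>\<omega>. ?p ^ ?Z \<omega>)"
  proof (rule integral_mono)
    show "integrable M (\<lambda>\<omega>. ?p ^ ?Z \<omega>)"
      by (rule integrable_const_bound[where B = 1]) (auto intro!: power_le_one)
    show "1 + real (?Z \<omega>) * (?p - 1) \<le> ?p ^ ?Z \<omega>" for \<omega>
      using Bernoulli_inequality[of "?p - 1" "?Z \<omega>"] measure_nonneg[of M] by (simp add: algebra_simps)
  qed (use Z_integrable in auto)
  also have "\<dots> = expectation ?W"
    unfolding p[symmetric] by (rule expectation_prod_offspring[symmetric]) (simp add: indicator_def)
  also have "\<dots> \<le> expectation (indicator {\<omega> \<in> space M. ?Z' \<omega> = ?Z \<omega>})"
  proof (rule integral_mono)
    show "integrable M ?W"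
      by (rule integrable_const_bound[where B = 1, OF _ W]) (unfold W_ind, auto)
    show "integrable M (indicator {\<omega> \<in> space M. ?Z' \<omega> = ?Z \<omega>} :: _ \<Rightarrow> real)"
      using stay by (intro integrable_real_indicator) (auto simp: less_top[symmetric])
  qed (rule W_le)
  also have "\<dots> = 1 - prob {\<omega> \<in> space M. ?Z' \<omega> \<noteq> ?Z \<omega>}"
    using stay by (subst prob_neg) simp_all
  finally show ?thesis by simp
qed


text \<open>Written for summation over \<open>n\<close>: the first increment has a coefficient that
  stays bounded when \<open>A_seq a\<close> has a positive limit, and the second telescopes as it
  stands.\<close>

lemma prob_jump_le_telescoping:
  "prob {\<omega> \<in> space M. gw_process X (Suc n) \<omega> \<noteq> gw_process X n \<omega>}
    \<le> 2 * (A_seq a n powr (- 1 / \<theta>) / A_seq a n / \<theta>)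
        * ((A_seq a (Suc n) + C_seq a c (Suc n)) - (A_seq a n + C_seq a c n))
      + (A_seq a (Suc n) powr (- 1 / \<theta>) - A_seq a n powr (- 1 / \<theta>))"
proof -
  let ?M = "A_seq a n powr (- 1 / \<theta>)" and ?y = "a (Suc n) + c (Suc n)"
  \<comment> \<open>\<open>c_ge\<close> enters as \<open>?y \<ge> 1\<close>, which
    \<open>one_minus_powr_neg_le\<close> requires.\<close>
  have pos: "a (Suc n) > 0" "c (Suc n) > 0" "?y \<ge> 1"
    using a_pos[of "Suc n"] c_pos[of "Suc n"] c_ge[of "Suc n"] by auto
  have X1: "X (Suc n) 1 \<in> measurable M (count_space UNIV)"
    by (rule X_measurable) auto
  have pgf: "expectation (\<lambda>\<omega>. s ^ X (Suc n) 1 \<omega>) = theta_pgf \<theta> (a (Suc n)) (c (Suc n)) s"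
    if "0 \<le> s" "s \<le> 1" for s
    using that by (intro X_pgf) auto
  note mean = theta_pgf_mean[OF X1 pgf theta(1) pos(1) less_imp_le[OF pos(2)]]
  have "1 - prob {\<omega> \<in> space M. X (Suc n) 1 \<omega> = 1}
      \<le> 2 * (1 - ?y powr (- 1 / \<theta>)) + a (Suc n) powr (- 1 / \<theta>) - 1"
    using prob_neq_one_le[OF X1 mean(1)] mean(2) theta_pgf_prob_zero[OF X1 pgf] by simp
  also have "1 - ?y powr (- 1 / \<theta>) \<le> 1 / \<theta> * (?y - 1)"
    using one_minus_powr_neg_le[OF pos(3), of "1 / \<theta>"] theta by simp
  finally have "1 - prob {\<omega> \<in> space M. X (Suc n) 1 \<omega> = 1}
      \<le> 2 * (1 / \<theta> * (?y - 1)) + a (Suc n) powr (- 1 / \<theta>) - 1" by simp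
  then have "?M * (1 - prob {\<omega> \<in> space M. X (Suc n) 1 \<omega> = 1})
      \<le> ?M * (2 * (1 / \<theta> * (?y - 1)) + a (Suc n) powr (- 1 / \<theta>) - 1)"
    by (rule mult_left_mono) simp
  also have "\<dots> = 2 * (?M / A_seq a n / \<theta>) * (A_seq a n * (?y - 1)) + (?M * a (Suc n) powr (- 1 / \<theta>) - ?M)"
    using A_seq_pos[of n] theta by (simp add: field_simps)
  also have "A_seq a n * (?y - 1) = (A_seq a (Suc n) + C_seq a c (Suc n)) - (A_seq a n + C_seq a c n)"
    by (simp add: A_seq_Suc C_seq_Suc algebra_simps)
  also have "?M * a (Suc n) powr (- 1 / \<theta>) = A_seq a (Suc n) powr (- 1 / \<theta>)"
    using A_seq_pos[of n] pos by (simp add: A_seq_Suc powr_mult)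
  finally show ?thesis
    using prob_jump_le[of n] by linarith
qed

text \<open>The sign of this increment permits replacing its coefficient in the jump bound by a
  constant.\<close>

lemma A_plus_C_mono: "A_seq a n + C_seq a c n \<le> A_seq a (Suc n) + C_seq a c (Suc n)"
proof -
  have "0 \<le> A_seq a n * (a (Suc n) + c (Suc n) - 1)"
    using c_ge[of "Suc n"] A_seq_pos[of n] by (intro mult_nonneg_nonneg) auto
  then show ?thesis by (simp add: A_seq_Suc C_seq_Suc algebra_simps)
qed

lemma summable_prob_jump:
  assumes A: "A_seq a \<longlonglongrightarrow> A" "0 < A" and C: "C_seq a c \<longlonglongrightarrow> C"
  shows "summable (\<lambda>n. prob {\<omega> \<in> space M. gw_process X (Suc n) \<omega> \<noteq> gw_process X n \<omega>})"
proof -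
  define D where "D n = (A_seq a (Suc n) + C_seq a c (Suc n)) - (A_seq a n + C_seq a c n)" for n
  define E where "E n = A_seq a (Suc n) powr (- 1 / \<theta>) - A_seq a n powr (- 1 / \<theta>)" for n
  have D_nonneg: "D n \<ge> 0" for n
    using A_plus_C_mono[of n] by (simp add: D_def)
  have D_sum: "summable D"
    unfolding D_def by (rule telescope_summable[OF tendsto_add[OF A(1) C]])
  have E_sum: "summable E"
    unfolding E_def by (rule telescope_summable) (use A in \<open>auto intro!: tendsto_intros\<close>)
  \<comment> \<open>Because \<open>0 < A\<close>, the coefficient of \<open>D n\<close> converges,
    hence is bounded by some \<open>K\<close>. \<open>E n\<close> may have either sign, but carries
    no varying coefficient.\<close>
  have "(\<lambda>n. A_seq a n powr (- 1 / \<theta>) / A_seq a n / \<theta>) \<longlonglongrightarrow> A powr (- 1 / \<theta>) / A / \<theta>"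
    using A theta by (intro tendsto_intros) auto
  then have "Bseq (\<lambda>n. A_seq a n powr (- 1 / \<theta>) / A_seq a n / \<theta>)"
    by (intro convergent_imp_Bseq convergentI)
  then obtain K where K: "\<And>n. norm (A_seq a n powr (- 1 / \<theta>) / A_seq a n / \<theta>) \<le> K"
    by (rule BseqE) blast
  have bound: "norm (prob {\<omega> \<in> space M. gw_process X (Suc n) \<omega> \<noteq> gw_process X n \<omega>}) \<le> 2 * K * D n + E n"
    for n
  proof -
    have "2 * (A_seq a n powr (- 1 / \<theta>) / A_seq a n / \<theta>) * D n \<le> 2 * K * D n"
      using abs_le_D1[OF K[of n, unfolded real_norm_def]] D_nonneg[of n]
      by (intro mult_right_mono mult_left_mono) auto
    then show ?thesis
      using prob_jump_le_telescoping[of n] unfolding D_def E_def real_norm_def abs_of_nonneg[OF measure_nonneg]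
      by linarith
  qed
  have "summable (\<lambda>n. 2 * K * D n + E n)"
    by (intro summable_add summable_mult D_sum E_sum)
  then show ?thesis
    by (rule summable_comparison_test'[OF _ bound])
qed

section \<open>The almost sure limit and its law\<close>

lemma AE_eventually_constant:
  assumes "A_seq a \<longlonglongrightarrow> A" "0 < A" "C_seq a c \<longlonglongrightarrow> C"
  shows "AE \<omega> in M. \<exists>k. eventually (\<lambda>n. gw_process X n \<omega> = k) sequentially"
proof -
  let ?J = "\<lambda>n. {\<omega> \<in> space M. gw_process X (Suc n) \<omega> \<noteq> gw_process X n \<omega>}"
  have "AE \<omega> in M. eventually (\<lambda>n. \<omega> \<in> space M - ?J n) sequentially"
  proof (rule borel_cantelli_AE1)
    have "{\<omega> \<in> space M. gw_process X (Suc n) \<omega> = gw_process X n \<omega>} \<in> events" for n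
      by (rule sets_Collect_eq_nat) (rule Z_measurable)+
    then show "?J n \<in> events" for n
      by (rule sets.sets_Collect_neg)
  qed (auto simp: less_top[symmetric] simp del: gw_process.simps intro!: summable_prob_jump[OF assms])
  then show ?thesis
  proof eventually_elim
    case (elim \<omega>)
    then obtain N where N: "\<And>n. n \<ge> N \<Longrightarrow> gw_process X (Suc n) \<omega> = gw_process X n \<omega>"
      unfolding eventually_sequentially by blast
    have "gw_process X n \<omega> = gw_process X N \<omega>" if "n \<ge> N" for n
      using that by (induction n rule: dec_induct) (simp_all add: N del: gw_process.simps)
    then show ?case
      unfolding eventually_sequentially by blast
  qed
qed

lemma AE_limit:
  assumes A: "A_seq a \<longlonglongrightarrow> A" "0 < A" and C: "C_seq a c \<longlonglongrightarrow> C"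
  obtains Zinf where "Zinf \<in> measurable M (count_space UNIV)"
    and "AE \<omega> in M. eventually (\<lambda>n. gw_process X n \<omega> = Zinf \<omega>) sequentially"
    and "\<And>s. 0 \<le> s \<Longrightarrow> s \<le> 1 \<Longrightarrow> expectation (\<lambda>\<omega>. s ^ Zinf \<omega>) = theta_pgf \<theta> A C s"
proof
  \<comment> \<open>On eventually constant paths this is the eventual value; on the remaining null
    set, rounding \<open>lim\<close> still gives a measurable integer value.\<close>
  let ?Z = "\<lambda>\<omega>. nat \<lfloor>lim (\<lambda>n. real (gw_process X n \<omega>))\<rfloor>"
  have "(\<lambda>\<omega>. lim (\<lambda>n. real (gw_process X n \<omega>))) \<in> borel_measurable M"
    by (rule borel_measurable_lim_metric) (rule measurable_compose[OF Z_measurable], simp)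
  then have "(\<lambda>\<omega>. \<lfloor>lim (\<lambda>n. real (gw_process X n \<omega>))\<rfloor>) \<in> measurable M (count_space UNIV)"
    by (rule measurable_compose[OF _ measurable_real_floor])
  then show Z [measurable]: "?Z \<in> measurable M (count_space UNIV)"
    by (rule measurable_compose) simp
  show ev: "AE \<omega> in M. eventually (\<lambda>n. gw_process X n \<omega> = ?Z \<omega>) sequentially"
    using AE_eventually_constant[OF assms]
  proof eventually_elim
    case (elim \<omega>)
    then obtain k where k: "eventually (\<lambda>n. gw_process X n \<omega> = k) sequentially" by blast
    then have "(\<lambda>n. real (gw_process X n \<omega>)) \<longlonglongrightarrow> real k"
      by (intro tendsto_eventually) (auto elim: eventually_mono)
    then have "?Z \<omega> = k"
      by (simp add: limI)
    then show ?case using k by simp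
  qed
  fix s :: real assume s: "0 \<le> s" "s \<le> 1"
  have "(\<lambda>n. expectation (\<lambda>\<omega>. s ^ gw_process X n \<omega>)) \<longlonglongrightarrow> expectation (\<lambda>\<omega>. s ^ ?Z \<omega>)"
  proof (rule integral_dominated_convergence[where w = "\<lambda>_. 1"])
    \<comment> \<open>Eventual equality of the exponents passes to the powers for every
      \<open>s\<close>, including 0.\<close>
    show "AE \<omega> in M. (\<lambda>n. s ^ gw_process X n \<omega>) \<longlonglongrightarrow> s ^ ?Z \<omega>"
      using ev by eventually_elim (auto intro!: tendsto_eventually elim: eventually_mono)
  qed (use s in \<open>auto intro!: AE_I2 power_le_one\<close>)
  moreover have "(\<lambda>n. expectation (\<lambda>\<omega>. s ^ gw_process X n \<omega>)) \<longlonglongrightarrow> theta_pgf \<theta> A C s"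
    using theta_pgf_tendsto[OF A(1) C A(2) _ s(2)] LIMSEQ_le_const[OF C] C_seq_nonneg
    by (simp add: Z_pgf s)
  ultimately show "expectation (\<lambda>\<omega>. s ^ ?Z \<omega>) = theta_pgf \<theta> A C s"
    by (rule LIMSEQ_unique)
qed

end

theorem theorem2:
  fixes M :: "'w measure"
    and \<theta> A C :: real
    and a c :: "nat \<Rightarrow> real"
    and p :: "nat \<Rightarrow> nat \<Rightarrow> real"
    and X :: "nat \<Rightarrow> nat \<Rightarrow> 'w \<Rightarrow> nat"
  assumes "gw_theta M \<theta> a c p X"
    and "C_seq a c \<longlonglongrightarrow> C"
    and "A_seq a \<longlonglongrightarrow> A"
    and "0 < A"
  shows "(\<lambda>n. measure M {\<omega> \<in> space M. gw_process X n \<omega> = 0}) \<longlonglongrightarrow> 1 - (A + C) powr (- 1 / \<theta>) \<and>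
         (\<forall>n. integrable M (\<lambda>\<omega>. real (gw_process X n \<omega>))) \<and>
         (\<lambda>n. \<integral>\<omega>. real (gw_process X n \<omega>) \<partial>M) \<longlonglongrightarrow> A powr (- 1 / \<theta>) \<and>
         (\<exists>Zinf :: 'w \<Rightarrow> nat.
           Zinf \<in> measurable M (count_space UNIV) \<and>
           (AE \<omega> in M. (\<lambda>n. real (gw_process X n \<omega>)) \<longlonglongrightarrow> real (Zinf \<omega>)) \<and>
           integrable M (\<lambda>\<omega>. real (Zinf \<omega>)) \<and>
           (\<integral>\<omega>. real (Zinf \<omega>) \<partial>M) = A powr (- 1 / \<theta>) \<and>
           (\<forall>s\<in>{0..1}. (\<integral>\<omega>. s ^ Zinf \<omega> \<partial>M) = theta_pgf \<theta> A C s))"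
proof -
  interpret gw_theta M \<theta> a c p X by fact
  note C = assms(2) and A = assms(3,4)
  have C_nonneg: "C \<ge> 0"
    using LIMSEQ_le_const[OF C] C_seq_nonneg by blast
  obtain Zinf where Zinf: "Zinf \<in> measurable M (count_space UNIV)"
      "AE \<omega> in M. eventually (\<lambda>n. gw_process X n \<omega> = Zinf \<omega>) sequentially"
      "\<And>s. 0 \<le> s \<Longrightarrow> s \<le> 1 \<Longrightarrow> expectation (\<lambda>\<omega>. s ^ Zinf \<omega>) = theta_pgf \<theta> A C s"
    by (rule AE_limit[OF A C]) blast
  have "AE \<omega> in M. (\<lambda>n. real (gw_process X n \<omega>)) \<longlonglongrightarrow> real (Zinf \<omega>)"
    using Zinf(2) by eventually_elim (auto intro!: tendsto_eventually elim: eventually_mono)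
  \<comment> \<open>The generating function of \<open>Zinf\<close> lies in the same family, so its
    mean is read off directly, without exchanging limit and expectation along the process.\<close>
  moreover note theta_pgf_mean[OF Zinf(1,3) theta(1) A(2) C_nonneg]
  moreover have "(\<lambda>n. prob {\<omega> \<in> space M. gw_process X n \<omega> = 0}) \<longlonglongrightarrow> 1 - (A + C) powr (- 1 / \<theta>)"
    unfolding Z_prob_zero using A C C_nonneg by (intro tendsto_intros) auto
  moreover have "(\<lambda>n. expectation (\<lambda>\<omega>. real (gw_process X n \<omega>))) \<longlonglongrightarrow> A powr (- 1 / \<theta>)"
    unfolding Z_mean using A by (intro tendsto_intros) auto
  ultimately show ?thesis
    using Zinf(1,3) Z_integrable by auto
qed

end
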